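(* Let $\mu,\mu^\nu\in\mathscr{P}(\Xi)$ ($\nu\in\mathbb{N}$), let $g_0:\mathbb{R}^n\to\overline{\mathbb{R}}$ be proper and lsc, let $h:\mathbb{R}^m\to\overline{\mathbb{R}}$ be proper, lsc and nondecreasing, and let $G,G^\nu:\Xi\times\mathbb{R}^n\to\mathbb{R}^m$ be mappings with random lsc component functions. Assume that the mappings $G(\cdot,x),G^\nu(\cdot,x)$ are uniformly bounded on $\Xi$, locally uniformly in $x$. Let $\alpha\ge1$, and define $$\phi(x)=g_0(x)+h\big(\mathbb{E}_\mu[G(\boldsymbol{\xi},x)]\big),\qquad f(u,x)=g_0(x)+h\big(u+\mathbb{E}_\mu[G(\boldsymbol{\xi},x)]\big)+\iota_{\{0\}^m}(u),$$ $$f^\nu(u,x)=g_0(x)+h\big(u+\mathbb{E}_{\mu^\nu}[G^\nu(\boldsymbol{\xi},x)]\big)+\tfrac{1}{\alpha\lambda^\nu}\|u\|_2^\alpha .$$ Let $x_0\in\operatorname{argmin}\phi$ and suppose that: (i) for every $\nu$, $G^\nu(\xi,x_0)\le G(\xi,x_0)$ for $\mu$-a.e. $\xi$; (ii) $\liminf_{\nu} \mathbb{E}_{\mu^\nu}[G^\nu(\boldsymbol{\xi},x^\nu)]\ge \mathbb{E}_\mu[G(\boldsymbol{\xi},x)]$ (componentwise) for every $x\in\mathbb{R}^n$ and every $x^\nu\to x$; (iii) $\lambda^\nu\in(0,\infty)$, $\lambda^\nu\to0$, and $(\lambda^\nu)^{-1/\alpha}\big(\mathbb{E}_{\mu^\nu}[G^\nu(\boldsymbol{\xi},x_0)]-\mathbb{E}_\mu[G^\nu(\boldsymbol{\xi},x_0)]\big)\to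 0$. Then for any $\epsilon\in[0,\infty)$: (a) $\inf f=\inf\phi$ and $\epsilon\text{-}\operatorname{argmin} f=\{0\}\times \epsilon\text{-}\operatorname{argmin}\phi$; (b) $\limsup_\nu(\inf f^\nu)\le\inf f$; (c) if $\epsilon^\nu\in[0,\infty)\to\epsilon$, then $\operatorname{LimOut}(\epsilon^\nu\text{-}\operatorname{argmin}f^\nu)\subseteq\epsilon\text{-}\operatorname{argmin} f$; (d) if $\epsilon^\nu\in[0,\infty)\to0$ and, for some infinite $N\subseteq\mathbb{N}$, points $(u^\nu,x^\nu)\in\epsilon^\nu\text{-}\operatorname{argmin}f^\nu$, $\nu\in N$, converge along $N$, then $\lim_{\nu\in N}(\inf f^\nu)=\inf f$; (e) $\inf f^\nu\to\inf f$ if and only if the functions $f^\nu$ are tight; (f) if $\inf f^\nu\to\inf f$, then there exist $\epsilon^\nu\in[0,\infty)\to0$ such that $(0,x_0)\in\operatorname{LimInn}(\epsilon^\nu\text{-}\operatorname{argmin}f^\nu)$. Moreover, if conditions (i) and (iii) hold with every point of $\operatorname{dom}g_0$ in the role of $x_0$, with the same parameters $\lambda^\nu$, then $f^\nu$ epi-converge to $f$ and, consequently, (g) if $\inf f^\nu\to\inf f$, then there exist $\epsilon^\nu\in[0,\infty)\to0$ such that $\operatorname{Lim}(\epsilon^\nu\text{-}\operatorname{argmin}f^\nu)=\operatorname{argmin} f$.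
   Context: $\Xi\subseteq\mathbb{R}^d$ is nonempty and closed; $\mathscr{P}(\Xi)$ is the set of Borel probability measures on $\Xi$; $\overline{\mathbb{R}}=[-\infty,\infty]$; lsc = lower semicontinuous. $\iota_C(x)=0$ if $x\in C$ and $\infty$ otherwise. A function is proper if it never takes the value $-\infty$ and is not identically $\infty$. $h$ is nondecreasing if $h(y)\ge h(z)$ whenever $y\ge z$ componentwise. Vector inequalities are componentwise. $\mathbb{E}_\mu[G(\boldsymbol\xi,x)]=\int_\Xi G(\xi,x)\,\mu(d\xi)$. A function $g:\Xi\times\mathbb{R}^n\to\overline{\mathbb{R}}$ is random lsc if $\xi\mapsto \operatorname{epi} g(\xi,\cdot)=\{(x,t): g(\xi,x)\le t\}$ is closed-valued and measurable (i.e. $\{\xi\in\Xi:\operatorname{epi}g(\xi,\cdot)\cap O\ne\emptyset\}$ is Borel for every open $O\subseteq\mathbb{R}^{n+1}$). The mappings $G(\cdot,x),G^\nu(\cdot,x)$ are uniformly bounded on $\Xi$, locally uniformly in $x$, if for every $x\in\mathbb{R}^n$ there are $\epsilon_x>0$, $M_x<\infty$ such that $\|G(\xi,y)\|_2\le M_x$ and $\|G^\nu(\xi,y)\|_2\le M_x$ for all $\nu$, $\xi\in\Xi$ and $\|y-x\|_2\le\epsilon_x$. For $\psi:\mathbb{R}^k\to\overline{\mathbb{R}}$: $\operatorname{dom}\psi=\{\psi<\infty\}$, $\operatorname{argmin}\psi=\{z\in\operatorname{dom}\psi:\psi(z)=\inf\psi\}$, $\epsilon\text{-}\operatorname{argmin}\psi=\{z\in\operatorname{dom}\psi:\psi(z)\le\inf\psi+\epsilon\}$.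 For sets $C^\nu\subseteq\mathbb{R}^k$: $\operatorname{LimOut}C^\nu$ is the set of limits of sequences $z^\nu\in C^\nu$, $\nu\in N$, over infinite $N\subseteq\mathbb{N}$; $\operatorname{LimInn}C^\nu$ is the set of limits of sequences $z^\nu\in C^\nu$, $\nu\in\mathbb{N}$; $\operatorname{Lim}C^\nu=C$ means both equal $C$. $\psi^\nu$ epi-converge to $\psi$ if for every $z$: $\liminf\psi^\nu(z^\nu)\ge\psi(z)$ for all $z^\nu\to z$ and $\limsup\psi^\nu(z^\nu)\le\psi(z)$ for some $z^\nu\to z$. The functions $\psi^\nu$ are tight if for every $\epsilon>0$ there are a compact set $S_\epsilon$ and $\nu_\epsilon$ with $\inf_{S_\epsilon}\psi^\nu\le\inf\psi^\nu+\epsilon$ for all $\nu\ge\nu_\epsilon$.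
   Formalization: LimInn is taken with z^ν∈C^ν only for all sufficiently large ν, not for every ν∈ℕ; read literally, (f) and (g) fail when some initial f^ν has inf f^ν=−∞, since its ε-argmin is then empty. *)

theory Defs
  imports "HOL-Probability.Probability_Measure"
begin

definition borel_probs :: "'a::topological_space set \<Rightarrow> 'a measure set" where
  "borel_probs \<Xi> = {\<mu>. prob_space \<mu> \<and> sets \<mu> = sets (restrict_space borel \<Xi>)}"

definition indicator_fun :: "'a set \<Rightarrow> 'a \<Rightarrow> ereal" where
  "indicator_fun C x = (if x \<in> C then 0 else \<infinity>)"

definition proper_fun :: "('a \<Rightarrow> ereal) \<Rightarrow> bool" where
  "proper_fun \<psi> \<longleftrightarrow> (\<forall>z. \<psi> z \<noteq> -\<infinity>) \<and> (\<exists>z. \<psi> z \<noteq> \<infinity>)"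

definition lsc :: "('a::topological_space \<Rightarrow> ereal) \<Rightarrow> bool" where
  "lsc \<psi> \<longleftrightarrow> (\<forall>z. \<psi> z \<le> Liminf (at z) \<psi>)"

definition epi :: "('a \<Rightarrow> ereal) \<Rightarrow> ('a \<times> real) set" where
  "epi \<psi> = {(x, t). \<psi> x \<le> ereal t}"

text \<open>\<open>\<Xi>\<close> is closed in all uses below, so membership in \<open>sets borel\<close> is the same
  as being a Borel subset of \<open>\<Xi>\<close>.\<close>

definition random_lsc ::
    "'s::topological_space set \<Rightarrow> ('s \<Rightarrow> 'a::topological_space \<Rightarrow> ereal) \<Rightarrow> bool" where
  "random_lsc \<Xi> g \<longleftrightarrow>
     (\<forall>\<xi>\<in>\<Xi>. closed (epi (g \<xi>))) \<and>
     (\<forall>U. open U \<longrightarrow> {\<xi>\<in>\<Xi>. epi (g \<xi>) \<inter> U \<noteq> {}} \<in> sets borel)"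

definition locally_uniformly_bounded ::
    "'s set \<Rightarrow> ('s \<Rightarrow> 'a::metric_space \<Rightarrow> 'b::real_normed_vector) \<Rightarrow>
     (nat \<Rightarrow> 's \<Rightarrow> 'a \<Rightarrow> 'b) \<Rightarrow> bool" where
  "locally_uniformly_bounded \<Xi> G G' \<longleftrightarrow>
     (\<forall>x. \<exists>e>0. \<exists>M. \<forall>\<nu>. \<forall>\<xi>\<in>\<Xi>. \<forall>y. dist y x \<le> e \<longrightarrow>
        norm (G \<xi> y) \<le> M \<and> norm (G' \<nu> \<xi> y) \<le> M)"

definition eff_dom :: "('a \<Rightarrow> ereal) \<Rightarrow> 'a set" where
  "eff_dom \<psi> = {z. \<psi> z < \<infinity>}"

definition argmin :: "('a \<Rightarrow> ereal) \<Rightarrow> 'a set" where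
  "argmin \<psi> = {z \<in> eff_dom \<psi>. \<psi> z = (INF y. \<psi> y)}"

definition eps_argmin :: "real \<Rightarrow> ('a \<Rightarrow> ereal) \<Rightarrow> 'a set" where
  "eps_argmin \<epsilon> \<psi> = {z \<in> eff_dom \<psi>. \<psi> z \<le> (INF y. \<psi> y) + ereal \<epsilon>}"

text \<open>Convergence of a sequence whose indices are restricted to an infinite set \<open>N\<close> is
  convergence along the following filter; the values outside \<open>N\<close> are irrelevant.\<close>

abbreviation along :: "nat set \<Rightarrow> nat filter" where
  "along N \<equiv> inf sequentially (principal N)"

definition lim_out :: "(nat \<Rightarrow> 'a::topological_space set) \<Rightarrow> 'a set" where
  "lim_out C = {z. \<exists>N zs. infinite N \<and> (\<forall>\<nu>\<in>N. zs \<nu> \<in> C \<nu>) \<and> (zs \<longlongrightarrow> z) (along N)}"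

text \<open>As usual for Painleve-Kuratowski limits, the inner limit only sees the tail of the
  sequence of sets: finitely many \<open>C \<nu>\<close> may be empty.  If no \<open>C \<nu>\<close> is empty, the selection
  can be made for every index; see \<open>lim_inn_nonempty\<close>.\<close>

definition lim_inn :: "(nat \<Rightarrow> 'a::topological_space set) \<Rightarrow> 'a set" where
  "lim_inn C = {z. \<exists>zs. (\<forall>\<^sub>F \<nu> in sequentially. zs \<nu> \<in> C \<nu>) \<and> zs \<longlonglongrightarrow> z}"

lemma lim_inn_nonempty:
  assumes "\<And>\<nu>. C \<nu> \<noteq> {}"
  shows "lim_inn C = {z. \<exists>zs. (\<forall>\<nu>. zs \<nu> \<in> C \<nu>) \<and> zs \<longlonglongrightarrow> z}"
proof -
  have "\<exists>ys. (\<forall>\<nu>. ys \<nu> \<in> C \<nu>) \<and> ys \<longlonglongrightarrow> z"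
    if ev: "\<forall>\<^sub>F \<nu> in sequentially. zs \<nu> \<in> C \<nu>" and lim: "zs \<longlonglongrightarrow> z" for zs z
  proof -
    define ys where "ys \<nu> = (if zs \<nu> \<in> C \<nu> then zs \<nu> else (SOME y. y \<in> C \<nu>))" for \<nu>
    have "ys \<nu> \<in> C \<nu>" for \<nu>
      using assms[of \<nu>] by (auto simp: ys_def intro: someI)
    moreover have "\<forall>\<^sub>F \<nu> in sequentially. zs \<nu> = ys \<nu>"
      using ev by eventually_elim (simp add: ys_def)
    then have "ys \<longlonglongrightarrow> z"
      using lim Lim_transform_eventually by blast
    ultimately show ?thesis by blast
  qed
  moreover have "z \<in> lim_inn C" if "\<forall>\<nu>. zs \<nu> \<in> C \<nu>" "zs \<longlonglongrightarrow> z" for zs z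
    using that unfolding lim_inn_def by (auto intro!: exI[of _ zs])
  ultimately show ?thesis
    unfolding lim_inn_def by blast
qed

definition set_lim :: "(nat \<Rightarrow> 'a::topological_space set) \<Rightarrow> 'a set \<Rightarrow> bool" where
  "set_lim C D \<longleftrightarrow> lim_out C = D \<and> lim_inn C = D"

definition epi_converges ::
    "(nat \<Rightarrow> 'a::topological_space \<Rightarrow> ereal) \<Rightarrow> ('a \<Rightarrow> ereal) \<Rightarrow> bool" where
  "epi_converges \<psi>s \<psi> \<longleftrightarrow>
     (\<forall>z. (\<forall>zs. zs \<longlonglongrightarrow> z \<longrightarrow> \<psi> z \<le> liminf (\<lambda>\<nu>. \<psi>s \<nu> (zs \<nu>))) \<and>
          (\<exists>zs. zs \<longlonglongrightarrow> z \<and> limsup (\<lambda>\<nu>. \<psi>s \<nu> (zs \<nu>)) \<le> \<psi> z))"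

definition tight_funs :: "(nat \<Rightarrow> 'a::topological_space \<Rightarrow> ereal) \<Rightarrow> bool" where
  "tight_funs \<psi>s \<longleftrightarrow>
     (\<forall>\<epsilon>::real. \<epsilon> > 0 \<longrightarrow> (\<exists>S. compact S \<and> (\<exists>\<nu>0. \<forall>\<nu>\<ge>\<nu>0.
        (INF z\<in>S. \<psi>s \<nu> z) \<le> (INF z. \<psi>s \<nu> z) + ereal \<epsilon>)))"

end

theory Submission
  imports Defs
begin

text \<open>
  At a point \<open>x\<close> where \<open>G'\<close> is dominated by \<open>G\<close>, the shift
  \<open>u \<nu> = E\<^bsub>\<mu>\<^esub> G' - E\<^bsub>\<mu>' \<nu>\<^esub> G'\<close> turns the argument of \<open>h\<close> into \<open>E\<^bsub>\<mu>\<^esub> G'\<close>, which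
  lies below \<open>E\<^bsub>\<mu>\<^esub> G\<close>, while the rate condition makes the penalty of \<open>u \<nu>\<close> vanish; so \<open>(u \<nu>, x)\<close> is a
  recovery sequence for \<open>(0, x)\<close>.  The liminf half of epi-convergence holds everywhere, since
  \<open>h\<close> is nondecreasing and lsc and the penalty explodes away from \<open>u = 0\<close>.  The liminf half
  together with a single recovery sequence, at a minimizer, already yields (b)-(f).  For (g), the
  tolerances belonging to a countable dense set of minimizers are merged into one null sequence,
  and inner limits are closed.
\<close>

section \<open>Inner and outer limits of sets, approximate minimizers\<close>

lemma infinite_meets_eventually:
  assumes "infinite (N::nat set)" "\<forall>\<^sub>F \<nu> in sequentially. P \<nu>"
  obtains \<nu> where "\<nu> \<in> N" "P \<nu>"
  using assms by (metis eventually_sequentially infinite_nat_iff_unbounded_le)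

lemma eps_argmin_0: "eps_argmin 0 \<psi> = argmin \<psi>"
  unfolding eps_argmin_def argmin_def by (auto intro!: antisym INF_lower simp flip: zero_ereal_def)

lemma eps_argmin_mono: "a \<le> b \<Longrightarrow> eps_argmin a \<psi> \<subseteq> eps_argmin b \<psi>"
  unfolding eps_argmin_def
  by (auto elim!: order_trans intro!: add_left_mono)

text \<open>The tail of indices on which the selection is valid serves as the infinite index set of
  the outer limit.\<close>

lemma lim_inn_subset_lim_out: "lim_inn C \<subseteq> lim_out C"
proof
  fix z assume "z \<in> lim_inn C"
  then obtain zs M where zs: "\<And>\<nu>. \<nu> \<ge> M \<Longrightarrow> zs \<nu> \<in> C \<nu>" "zs \<longlonglongrightarrow> z"
    by (auto simp: lim_inn_def eventually_sequentially)
  then have "(zs \<longlongrightarrow> z) (along {M..})"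
    by (meson tendsto_mono inf_le1)
  then show "z \<in> lim_out C"
    using zs(1) by (auto simp: lim_out_def infinite_Ici intro!: exI[of _ "{M..}"] exI[of _ zs])
qed

text \<open>This trades a selection for a condition on distances. In the converse direction one
  selection has to serve every \<open>e\<close>, so an almost nearest point of
  \<open>C \<nu>\<close> is taken.\<close>

lemma lim_inn_iff:
  fixes C :: "nat \<Rightarrow> 'a::metric_space set"
  shows "z \<in> lim_inn C \<longleftrightarrow> (\<forall>e>0. \<forall>\<^sub>F \<nu> in sequentially. \<exists>y\<in>C \<nu>. dist y z < e)"
proof
  assume "z \<in> lim_inn C"
  then obtain zs where zs: "\<forall>\<^sub>F \<nu> in sequentially. zs \<nu> \<in> C \<nu>" "zs \<longlonglongrightarrow> z"
    by (auto simp: lim_inn_def)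
  show "\<forall>e>0. \<forall>\<^sub>F \<nu> in sequentially. \<exists>y\<in>C \<nu>. dist y z < e"
  proof (intro allI impI)
    fix e :: real assume "e > 0"
    then have "\<forall>\<^sub>F \<nu> in sequentially. dist (zs \<nu>) z < e"
      using zs(2) by (simp add: tendsto_iff)
    with zs(1) show "\<forall>\<^sub>F \<nu> in sequentially. \<exists>y\<in>C \<nu>. dist y z < e"
      by eventually_elim blast
  qed
next
  assume *: "\<forall>e>0. \<forall>\<^sub>F \<nu> in sequentially. \<exists>y\<in>C \<nu>. dist y z < e"
  \<comment> \<open>The distance to \<open>C \<nu>\<close> need not be attained; the slack
    \<open>1 / Suc \<nu>\<close> guarantees a choice and vanishes in the limit.\<close>
  define zs where "zs \<nu> = (SOME y. y \<in> C \<nu> \<and> dist z y < infdist z (C \<nu>) + 1 / Suc \<nu>)" for \<nu>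
  have zs: "zs \<nu> \<in> C \<nu> \<and> dist z (zs \<nu>) < infdist z (C \<nu>) + 1 / Suc \<nu>" if "C \<nu> \<noteq> {}" for \<nu>
  proof -
    have "(INF y\<in>C \<nu>. dist z y) < infdist z (C \<nu>) + 1 / Suc \<nu>"
      using that by (simp add: infdist_notempty)
    then have "\<exists>y. y \<in> C \<nu> \<and> dist z y < infdist z (C \<nu>) + 1 / Suc \<nu>"
      using that by (subst (asm) cINF_less_iff) auto
    then show ?thesis
      unfolding zs_def by (rule someI_ex)
  qed
  have "\<forall>\<^sub>F \<nu> in sequentially. zs \<nu> \<in> C \<nu>"
    using *[rule_format, OF zero_less_one] by eventually_elim (use zs in blast)
  moreover have "zs \<longlonglongrightarrow> z"
  proof (rule tendstoI)
    fix e :: real assume "e > 0"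
    then have "\<forall>\<^sub>F \<nu> in sequentially. \<exists>y\<in>C \<nu>. dist y z < e / 2"
      using * half_gt_zero by blast
    moreover have "\<forall>\<^sub>F \<nu> in sequentially. 1 / real (Suc \<nu>) < e / 2"
      using \<open>e > 0\<close> by (intro order_tendstoD(2)[OF lim_1_over_n[THEN LIMSEQ_Suc]]) simp
    ultimately show "\<forall>\<^sub>F \<nu> in sequentially. dist (zs \<nu>) z < e"
    proof eventually_elim
      case (elim \<nu>)
      then obtain y where "y \<in> C \<nu>" "dist y z < e / 2" by blast
      then have "infdist z (C \<nu>) < e / 2"
        by (metis dist_commute infdist_le order_le_less_trans)
      moreover have "dist z (zs \<nu>) < infdist z (C \<nu>) + 1 / Suc \<nu>"
        using zs \<open>y \<in> C \<nu>\<close> by blast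
      ultimately show ?case
        using elim(2) by (simp add: dist_commute)
    qed
  qed
  ultimately show "z \<in> lim_inn C"
    by (auto simp: lim_inn_def)
qed

text \<open>Half of \<open>e\<close> is spent on reaching a point of the inner limit, the other half
  on approximating that point from \<open>C \<nu>\<close>.\<close>

lemma closed_lim_inn: "closed (lim_inn (C :: nat \<Rightarrow> 'a::metric_space set))"
proof -
  have "z \<in> lim_inn C" if z: "z \<in> closure (lim_inn C)" for z
    unfolding lim_inn_iff
  proof (intro allI impI)
    fix e :: real assume "e > 0"
    then obtain w where w: "w \<in> lim_inn C" "dist w z < e / 2"
      using z unfolding closure_approachable by (meson half_gt_zero)
    have "\<forall>\<^sub>F \<nu> in sequentially. \<exists>y\<in>C \<nu>. dist y w < e / 2"
      using w(1) half_gt_zero[OF \<open>e > 0\<close>] unfolding lim_inn_iff by blast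
    then show "\<forall>\<^sub>F \<nu> in sequentially. \<exists>y\<in>C \<nu>. dist y z < e"
    proof eventually_elim
      case (elim \<nu>)
      then show ?case
        using dist_triangle_half_r[of w _ e z] w(2) by (metis dist_commute)
    qed
  qed
  then show ?thesis
    by (metis closure_subset closure_closed closed_closure subsetI subset_antisym)
qed

text \<open>Truncating the \<open>k\<close>-th sequence at \<open>1/(k+1)\<close> makes the supremum over all \<open>k\<close> a null
  sequence, while for fixed \<open>k\<close> the truncation is eventually inactive.\<close>

lemma common_null_majorant:
  fixes e :: "nat \<Rightarrow> nat \<Rightarrow> real"
  assumes nonneg: "\<And>k \<nu>. e k \<nu> \<ge> 0" and lim: "\<And>k. e k \<longlonglongrightarrow> 0"
  obtains es where "\<And>\<nu>. es \<nu> \<ge> 0" "es \<longlonglongrightarrow> 0" "\<And>k. \<forall>\<^sub>F \<nu> in sequentially. e k \<nu> \<le> es \<nu>"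
proof -
  define t where "t k \<nu> = min (e k \<nu>) (1 / Suc k)" for k \<nu>
  define es where "es \<nu> = (SUP k. t k \<nu>)" for \<nu>
  have t: "0 \<le> t k \<nu>" "t k \<nu> \<le> 1 / Suc k" "t k \<nu> \<le> e k \<nu>" for k \<nu>
    using nonneg by (auto simp: t_def)
  have "bdd_above (range (\<lambda>k. t k \<nu>))" for \<nu>
  proof (rule bdd_aboveI2)
    show "t k \<nu> \<le> 1" for k
      by (rule order_trans[OF t(2)]) simp
  qed
  then have le: "t k \<nu> \<le> es \<nu>" for k \<nu>
    unfolding es_def by (auto intro: cSUP_upper)
  have nonneg_es: "es \<nu> \<ge> 0" for \<nu>
    using t(1) le order_trans by blast
  show thesis
  proof
    show "es \<nu> \<ge> 0" for \<nu> by (rule nonneg_es)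
    show "es \<longlonglongrightarrow> 0"
    proof (rule tendstoI)
      fix d :: real assume "d > 0"
      \<comment> \<open>Only the finitely many sequences with index below \<open>K\<close> have to
        be waited for; from \<open>K\<close> on the cap \<open>1 / Suc k\<close> is already below
        \<open>d / 2\<close>.\<close>
      then obtain K where K: "inverse (real (Suc K)) < d / 2"
        using reals_Archimedean[of "d / 2"] by auto
      have "\<forall>\<^sub>F \<nu> in sequentially. e k \<nu> < d / 2" for k
        using \<open>d > 0\<close> by (intro order_tendstoD(2)[OF lim]) simp
      then have "\<forall>\<^sub>F \<nu> in sequentially. \<forall>k\<in>{..<K}. e k \<nu> < d / 2"
        by (intro eventually_ball_finite) auto
      then show "\<forall>\<^sub>F \<nu> in sequentially. dist (es \<nu>) 0 < d"
      proof eventually_elim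
        case (elim \<nu>)
        have "t k \<nu> \<le> d / 2" for k
        proof (cases "k < K")
          case True
          then show ?thesis using elim t(3)[of k \<nu>] by (meson lessThan_iff less_imp_le order_trans)
        next
          case False
          then have "1 / Suc k \<le> 1 / Suc K"
            by (intro divide_left_mono) auto
          then show ?thesis using t(2)[of k \<nu>] K by (simp add: inverse_eq_divide)
        qed
        then have "es \<nu> \<le> d / 2"
          unfolding es_def by (intro cSUP_least) auto
        then show ?case using nonneg_es[of \<nu>] \<open>d > 0\<close> by simp
      qed
    qed
    show "\<forall>\<^sub>F \<nu> in sequentially. e k \<nu> \<le> es \<nu>" for k
    proof -
      have "\<forall>\<^sub>F \<nu> in sequentially. e k \<nu> < 1 / Suc k"
        by (rule order_tendstoD(2)[OF lim]) simp
      then show ?thesis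
        by eventually_elim (metis le t_def min.absorb3)
    qed
  qed
qed

section \<open>Consequences of the liminf bound and an upper bound on infima\<close>

text \<open>Recovery sequences at all points are replaced by an upper bound on the infima, which one
  recovery sequence at a minimizer provides. The limit infimum \<open>b\<close> is real, while the
  infima of \<open>\<psi>s \<nu>\<close> may be infinite.\<close>

locale relaxed_epi_limit =
  fixes \<psi>s :: "nat \<Rightarrow> 'a::metric_space \<Rightarrow> ereal" and \<psi> :: "'a \<Rightarrow> ereal" and b :: real
  assumes liminf: "\<And>zs z. zs \<longlonglongrightarrow> z \<Longrightarrow> \<psi> z \<le> liminf (\<lambda>\<nu>. \<psi>s \<nu> (zs \<nu>))"
    and inf_limit: "(INF z. \<psi> z) = ereal b"
    and limsup_inf: "limsup (\<lambda>\<nu>. INF z. \<psi>s \<nu> z) \<le> ereal b"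
begin

text \<open>Outside \<open>N\<close> the sequence is filled up with the limit point
  \<open>z\<close>, so that the liminf bound for full sequences applies.\<close>

lemma eventually_along_greater:
  assumes zs: "(zs \<longlongrightarrow> z) (along N)" and c: "c < \<psi> z"
  shows "\<forall>\<^sub>F \<nu> in sequentially. \<nu> \<in> N \<longrightarrow> c < \<psi>s \<nu> (zs \<nu>)"
proof -
  define ys where "ys \<nu> = (if \<nu> \<in> N then zs \<nu> else z)" for \<nu>
  have "ys \<longlonglongrightarrow> z"
  proof (rule topological_tendstoI)
    fix S assume "open S" "z \<in> S"
    then have "\<forall>\<^sub>F \<nu> in sequentially. \<nu> \<in> N \<longrightarrow> zs \<nu> \<in> S"
      using topological_tendstoD[OF zs] by (simp add: eventually_inf_principal)
    then show "\<forall>\<^sub>F \<nu> in sequentially. ys \<nu> \<in> S"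
      by eventually_elim (auto simp: ys_def \<open>z \<in> S\<close>)
  qed
  then have "\<forall>\<^sub>F \<nu> in sequentially. c < \<psi>s \<nu> (ys \<nu>)"
    using liminf c by (auto simp: le_Liminf_iff)
  then show ?thesis
    by eventually_elim (auto simp: ys_def)
qed

lemma eventually_inf_less: "b < c \<Longrightarrow> \<forall>\<^sub>F \<nu> in sequentially. (INF z. \<psi>s \<nu> z) < ereal c"
  using limsup_inf by (simp add: Limsup_le_iff)

text \<open>If \<open>\<psi> z\<close> exceeded \<open>b + \<epsilon>\<close>, the values along
  \<open>N\<close> would eventually stay above some \<open>c\<close> in between, although
  approximate minimality keeps them close to or below \<open>b + \<epsilon>\<close>.\<close>

lemma lim_out_eps_argmin_subset:
  assumes es: "es \<longlonglongrightarrow> \<epsilon>"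
  shows "lim_out (\<lambda>\<nu>. eps_argmin (es \<nu>) (\<psi>s \<nu>)) \<subseteq> eps_argmin \<epsilon> \<psi>"
proof
  fix z assume "z \<in> lim_out (\<lambda>\<nu>. eps_argmin (es \<nu>) (\<psi>s \<nu>))"
  then obtain N zs where N: "infinite N" and zs: "(zs \<longlongrightarrow> z) (along N)"
    and min: "\<And>\<nu>. \<nu> \<in> N \<Longrightarrow> \<psi>s \<nu> (zs \<nu>) \<le> (INF z. \<psi>s \<nu> z) + ereal (es \<nu>)"
    by (auto simp: lim_out_def eps_argmin_def)
  have "\<psi> z \<le> ereal (b + \<epsilon>)"
  proof (rule ccontr)
    assume "\<not> ?thesis"
    then obtain c where c: "ereal (b + \<epsilon>) < ereal c" "ereal c < \<psi> z"
      by (metis ereal_dense2 not_le)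
    \<comment> \<open>Half of the gap is granted to the infima and half to the tolerances. Together
      they use it up exactly, which suffices because the lower bound by \<open>c\<close> is
      strict.\<close>
    define d where "d = (c - b - \<epsilon>) / 2"
    have "d > 0" using c(1) by (simp add: d_def)
    have "\<forall>\<^sub>F \<nu> in sequentially. (INF z. \<psi>s \<nu> z) < ereal (b + d)"
      using \<open>d > 0\<close> by (intro eventually_inf_less) simp
    moreover have "\<forall>\<^sub>F \<nu> in sequentially. es \<nu> < \<epsilon> + d"
      using \<open>d > 0\<close> by (intro order_tendstoD(2)[OF es]) simp
    moreover note eventually_along_greater[OF zs c(2)]
    ultimately have "\<forall>\<^sub>F \<nu> in sequentially. \<nu> \<notin> N"
    proof eventually_elim
      case (elim \<nu>)
      have "(INF z. \<psi>s \<nu> z) + ereal (es \<nu>) \<le> ereal (b + d) + ereal (\<epsilon> + d)"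
        using elim by (intro add_mono) auto
      also have "\<dots> = ereal c" by (simp add: d_def field_simps)
      finally show ?case using elim(3) min[of \<nu>] by force
    qed
    then show False
      by (rule infinite_meets_eventually[OF N]) (rule notE)
  qed
  moreover from this have "\<psi> z < \<infinity>" by (metis ereal_infty_less(1) ereal_infty_less_eq(1) PInfty_neq_ereal(1))
  ultimately show "z \<in> eps_argmin \<epsilon> \<psi>"
    by (simp add: eps_argmin_def eff_dom_def inf_limit)
qed

text \<open>The upper bound is the locale assumption. For the lower one, \<open>\<psi> z\<close> is
  at least \<open>b\<close>, so the values along \<open>N\<close> cannot stay below
  \<open>b\<close>, and vanishing tolerances pass this on to the infima.\<close>

lemma tendsto_inf_along:
  assumes es: "es \<longlonglongrightarrow> 0" and zs: "(zs \<longlongrightarrow> z) (along N)"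
    and min: "\<And>\<nu>. \<nu> \<in> N \<Longrightarrow> zs \<nu> \<in> eps_argmin (es \<nu>) (\<psi>s \<nu>)"
  shows "((\<lambda>\<nu>. INF z. \<psi>s \<nu> z) \<longlongrightarrow> ereal b) (along N)"
proof (rule order_tendstoI)
  fix a assume "a < ereal b"
  then obtain c where c: "a < ereal c" "ereal c < ereal b"
    using ereal_dense2 by blast
  \<comment> \<open>The gap \<open>d - c\<close> absorbs the tolerance.\<close>
  then obtain d where d: "c < d" "d < b"
    using dense by auto
  have "ereal d < \<psi> z"
    using d(2) inf_limit INF_lower[of z UNIV \<psi>] by (metis UNIV_I less_ereal.simps(1) order_less_le_trans)
  from eventually_along_greater[OF zs this]
  have "\<forall>\<^sub>F \<nu> in sequentially. \<nu> \<in> N \<longrightarrow> ereal d < \<psi>s \<nu> (zs \<nu>)" .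
  moreover have "\<forall>\<^sub>F \<nu> in sequentially. es \<nu> < d - c"
    using d(1) by (intro order_tendstoD(2)[OF es]) simp
  ultimately have "\<forall>\<^sub>F \<nu> in sequentially. \<nu> \<in> N \<longrightarrow> a < (INF z. \<psi>s \<nu> z)"
  proof eventually_elim
    case (elim \<nu>)
    show ?case
    proof
      assume "\<nu> \<in> N"
      then have "ereal d < (INF z. \<psi>s \<nu> z) + ereal (es \<nu>)"
        using elim(1) min[of \<nu>] by (auto simp: eps_argmin_def)
      then have "ereal c < (INF z. \<psi>s \<nu> z)"
        using elim(2) by (cases "INF z. \<psi>s \<nu> z") auto
      then show "a < (INF z. \<psi>s \<nu> z)" using c(1) by order
    qed
  qed
  then show "\<forall>\<^sub>F \<nu> in along N. a < (INF z. \<psi>s \<nu> z)"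
    by (simp add: eventually_inf_principal)
next
  fix a assume "ereal b < a"
  then have "\<forall>\<^sub>F \<nu> in sequentially. (INF z. \<psi>s \<nu> z) < a"
    using limsup_inf by (simp add: Limsup_le_iff)
  then show "\<forall>\<^sub>F \<nu> in along N. (INF z. \<psi>s \<nu> z) < a"
    by (auto simp: eventually_inf_principal elim: eventually_mono)
qed

text \<open>Tightness places almost minimizers in one compact set. If the infima were at most some
  \<open>c < b\<close> infinitely often, a cluster point of these almost minimizers would violate
  the liminf bound.\<close>

lemma tendsto_inf_if_tight:
  assumes tight: "tight_funs \<psi>s"
  shows "(\<lambda>\<nu>. INF z. \<psi>s \<nu> z) \<longlonglongrightarrow> ereal b"
proof (rule order_tendstoI)
  fix a assume "a < ereal b"
  then obtain c where c: "a < ereal c" "c < b"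
    using ereal_dense2 by (metis less_ereal.simps(1))
  have "\<forall>\<^sub>F \<nu> in sequentially. ereal c < (INF z. \<psi>s \<nu> z)"
  proof (rule ccontr)
    assume "\<not> ?thesis"
    then have inf: "infinite {\<nu>. (INF z. \<psi>s \<nu> z) \<le> ereal c}"
      by (simp add: not_eventually not_less frequently_cofinite flip: cofinite_eq_sequentially)
    \<comment> \<open>Two multiples of \<open>e\<close> must fit strictly between \<open>c\<close>
      and \<open>b\<close>: one is the loss from tightness, the other turns a possibly unattained
      infimum into an actual point of \<open>S\<close>.\<close>
    define e where "e = (b - c) / 4"
    have e: "e > 0" "c + e + e < b" using c(2) by (auto simp: e_def field_simps)
    obtain S \<nu>0 where S: "compact S"
      and \<nu>0: "\<And>\<nu>. \<nu> \<ge> \<nu>0 \<Longrightarrow> (INF z\<in>S. \<psi>s \<nu> z) \<le> (INF z. \<psi>s \<nu> z) + ereal e"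
      using tight e(1) unfolding tight_funs_def by metis
    define N where "N = {\<nu>. (INF z. \<psi>s \<nu> z) \<le> ereal c} \<inter> {\<nu>0..}"
    have "N = {\<nu>. (INF z. \<psi>s \<nu> z) \<le> ereal c} - {..<\<nu>0}" by (auto simp: N_def)
    then have N: "infinite N" using inf by (simp add: Diff_infinite_finite)
    have "\<exists>z\<in>S. \<psi>s \<nu> z < ereal (c + e + e)" if "\<nu> \<in> N" for \<nu>
    proof -
      have "(INF z\<in>S. \<psi>s \<nu> z) \<le> (INF z. \<psi>s \<nu> z) + ereal e"
        using \<nu>0 that by (simp add: N_def)
      also have "\<dots> \<le> ereal c + ereal e"
        using that by (intro add_right_mono) (simp add: N_def)
      also have "\<dots> < ereal (c + e + e)" using e by simp
      finally show ?thesis by (simp add: INF_less_iff)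
    qed
    then obtain zs where zs: "\<And>\<nu>. \<nu> \<in> N \<Longrightarrow> zs \<nu> \<in> S \<and> \<psi>s \<nu> (zs \<nu>) < ereal (c + e + e)"
      by metis
    \<comment> \<open>Enumerating \<open>N\<close> increasingly gives an ordinary sequence in
      \<open>S\<close>, to which sequential compactness applies.\<close>
    define r where "r = enumerate N"
    have r: "strict_mono r" "\<And>k. r k \<in> N"
      using N by (auto simp: r_def strict_mono_enumerate enumerate_in_set)
    have "\<forall>k. (zs \<circ> r) k \<in> S" using zs r(2) by simp
    then obtain z s where z: "z \<in> S" "strict_mono s" "((zs \<circ> r) \<circ> s) \<longlonglongrightarrow> z"
      using S unfolding compact_def by metis
    define q where "q = r \<circ> s"
    have q: "strict_mono q" "range q \<subseteq> N"
      using r z(2) by (auto simp: q_def strict_mono_o)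
    then have inf_q: "infinite (range q)"
      by (simp add: strict_mono_imp_inj_on range_inj_infinite)
    \<comment> \<open>Convergence of the subsequence is read back as convergence along its index
      set; as \<open>q\<close> is increasing, indices in \<open>range q\<close> beyond
      \<open>q K\<close> come from arguments beyond \<open>K\<close>.\<close>
    have "(zs \<longlongrightarrow> z) (along (range q))"
    proof (rule topological_tendstoI)
      fix U assume "open U" "z \<in> U"
      then obtain K where K: "\<And>k. k \<ge> K \<Longrightarrow> zs (q k) \<in> U"
        using topological_tendstoD[OF z(3)] by (auto simp: q_def eventually_sequentially o_def)
      have "zs \<nu> \<in> U" if "\<nu> \<ge> q K" "\<nu> \<in> range q" for \<nu>
        using that K q(1) by (auto simp: strict_mono_less_eq)
      then show "\<forall>\<^sub>F \<nu> in along (range q). zs \<nu> \<in> U"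
        by (auto simp: eventually_inf_principal eventually_sequentially)
    qed
    moreover have "ereal (c + e + e) < \<psi> z"
      using e(2) inf_limit INF_lower[of z UNIV \<psi>]
      by (metis UNIV_I less_ereal.simps(1) order_less_le_trans)
    ultimately have "\<forall>\<^sub>F \<nu> in sequentially. \<nu> \<in> range q \<longrightarrow> ereal (c + e + e) < \<psi>s \<nu> (zs \<nu>)"
      by (rule eventually_along_greater)
    then obtain \<nu> where \<nu>: "\<nu> \<in> range q" "\<nu> \<in> range q \<longrightarrow> ereal (c + e + e) < \<psi>s \<nu> (zs \<nu>)"
      by (rule infinite_meets_eventually[OF inf_q])
    then have "ereal (c + e + e) < \<psi>s \<nu> (zs \<nu>)" by (rule mp[rotated])
    moreover have "\<psi>s \<nu> (zs \<nu>) < ereal (c + e + e)" using \<nu>(1) q(2) zs by blast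
    ultimately show False by (rule order_less_asym)
  qed
  then show "\<forall>\<^sub>F \<nu> in sequentially. a < (INF z. \<psi>s \<nu> z)"
    using c(1) by (auto elim: eventually_mono)
next
  fix a assume "ereal b < a"
  then show "\<forall>\<^sub>F \<nu> in sequentially. (INF z. \<psi>s \<nu> z) < a"
    using limsup_inf by (simp add: Limsup_le_iff)
qed

text \<open>The values of the given sequence eventually exceed the infima by arbitrarily little, so
  the same \<open>S\<close> serves every tolerance.\<close>

lemma tight_if_tendsto_inf:
  assumes inf: "(\<lambda>\<nu>. INF z. \<psi>s \<nu> z) \<longlonglongrightarrow> ereal b"
    and S: "compact S" "\<And>\<nu>. zs \<nu> \<in> S" and zs: "limsup (\<lambda>\<nu>. \<psi>s \<nu> (zs \<nu>)) \<le> ereal b"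
  shows "tight_funs \<psi>s"
  unfolding tight_funs_def
proof (intro allI impI)
  fix e :: real assume "e > 0"
  have "\<forall>\<^sub>F \<nu> in sequentially. \<psi>s \<nu> (zs \<nu>) < ereal (b + e / 2)"
    using zs \<open>e > 0\<close> by (simp add: Limsup_le_iff)
  moreover have "\<forall>\<^sub>F \<nu> in sequentially. ereal (b - e / 2) < (INF z. \<psi>s \<nu> z)"
    using \<open>e > 0\<close> by (intro order_tendstoD(1)[OF inf]) simp
  ultimately have "\<forall>\<^sub>F \<nu> in sequentially.
      (INF z\<in>S. \<psi>s \<nu> z) \<le> (INF z. \<psi>s \<nu> z) + ereal e"
  proof eventually_elim
    case (elim \<nu>)
    have "(INF z\<in>S. \<psi>s \<nu> z) \<le> \<psi>s \<nu> (zs \<nu>)"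
      by (rule INF_lower) (rule S(2))
    also have "\<dots> \<le> ereal (b - e / 2) + ereal e" using elim(1) by (simp add: algebra_simps)
    also have "\<dots> \<le> (INF z. \<psi>s \<nu> z) + ereal e"
      using elim(2) by (intro add_right_mono) simp
    finally show ?case .
  qed
  then show "\<exists>S. compact S \<and> (\<exists>\<nu>0. \<forall>\<nu>\<ge>\<nu>0. (INF z\<in>S. \<psi>s \<nu> z) \<le> (INF z. \<psi>s \<nu> z) + ereal e)"
    using S(1) unfolding eventually_sequentially by blast
qed

text \<open>The excess of the values over the infima is itself a suitable tolerance: the values,
  squeezed between the infima and the limsup bound, tend to \<open>b\<close> as well.\<close>

lemma near_minimizers:
  assumes inf: "(\<lambda>\<nu>. INF z. \<psi>s \<nu> z) \<longlonglongrightarrow> ereal b"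
    and zs: "zs \<longlonglongrightarrow> z" "limsup (\<lambda>\<nu>. \<psi>s \<nu> (zs \<nu>)) \<le> ereal b"
  obtains es where "\<And>\<nu>. es \<nu> \<ge> 0" "es \<longlonglongrightarrow> 0"
    "\<forall>\<^sub>F \<nu> in sequentially. zs \<nu> \<in> eps_argmin (es \<nu>) (\<psi>s \<nu>)"
proof -
  have val: "(\<lambda>\<nu>. \<psi>s \<nu> (zs \<nu>)) \<longlonglongrightarrow> ereal b"
  proof (rule order_tendstoI)
    fix a assume "a < ereal b"
    then have "\<forall>\<^sub>F \<nu> in sequentially. a < (INF z. \<psi>s \<nu> z)"
      by (rule order_tendstoD(1)[OF inf])
    then show "\<forall>\<^sub>F \<nu> in sequentially. a < \<psi>s \<nu> (zs \<nu>)"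
      by eventually_elim (meson INF_lower UNIV_I order_less_le_trans)
  next
    fix a assume "ereal b < a"
    then show "\<forall>\<^sub>F \<nu> in sequentially. \<psi>s \<nu> (zs \<nu>) < a"
      using zs(2) by (simp add: Limsup_le_iff)
  qed
  \<comment> \<open>\<open>real_of_ereal\<close> sends infinite values to 0, so the excess is
    meaningful only once both quantities are finite, which holds eventually. The maximum with 0
    keeps it nonnegative before that.\<close>
  define es where "es \<nu> = max 0 (real_of_ereal (\<psi>s \<nu> (zs \<nu>)) - real_of_ereal (INF z. \<psi>s \<nu> z))" for \<nu>
  show thesis
  proof
    show "es \<nu> \<ge> 0" for \<nu> by (simp add: es_def)
    have "es \<longlonglongrightarrow> max 0 (b - b)"
      unfolding es_def
      by (intro tendsto_max tendsto_diff tendsto_const lim_real_of_ereal val inf)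
    then show "es \<longlonglongrightarrow> 0" by simp
    have "\<forall>\<^sub>F \<nu> in sequentially. \<psi>s \<nu> (zs \<nu>) < ereal (b + 1)"
      by (rule order_tendstoD(2)[OF val]) simp
    moreover have "\<forall>\<^sub>F \<nu> in sequentially. ereal (b - 1) < (INF z. \<psi>s \<nu> z)"
      by (rule order_tendstoD(1)[OF inf]) simp
    ultimately show "\<forall>\<^sub>F \<nu> in sequentially. zs \<nu> \<in> eps_argmin (es \<nu>) (\<psi>s \<nu>)"
    proof eventually_elim
      case (elim \<nu>)
      have "(INF z. \<psi>s \<nu> z) \<le> \<psi>s \<nu> (zs \<nu>)" by (rule INF_lower) simp
      with elim show ?case
        by (cases "\<psi>s \<nu> (zs \<nu>)"; cases "INF z. \<psi>s \<nu> z") (auto simp: eps_argmin_def eff_dom_def es_def)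
    qed
  qed
qed

end

text \<open>For null tolerances the outer limit lies in \<open>argmin \<psi>\<close> and contains
  the inner one. What remains is a single tolerance sequence that reaches all minimizers; second
  countability reduces these to countably many.\<close>

lemma argmin_set_lim:
  fixes \<psi>s :: "nat \<Rightarrow> 'a::{metric_space, second_countable_topology} \<Rightarrow> ereal"
  assumes "relaxed_epi_limit \<psi>s \<psi> b" and epi: "epi_converges \<psi>s \<psi>"
    and inf: "(\<lambda>\<nu>. INF z. \<psi>s \<nu> z) \<longlonglongrightarrow> ereal b"
  obtains es where "\<And>\<nu>. es \<nu> \<ge> 0" "es \<longlonglongrightarrow> 0"
    "set_lim (\<lambda>\<nu>. eps_argmin (es \<nu>) (\<psi>s \<nu>)) (argmin \<psi>)"
proof -
  note result = that
  interpret relaxed_epi_limit \<psi>s \<psi> b by fact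
  have sandwich: thesis
    if es: "\<And>\<nu>. es \<nu> \<ge> 0" "es \<longlonglongrightarrow> 0" "argmin \<psi> \<subseteq> lim_inn (\<lambda>\<nu>. eps_argmin (es \<nu>) (\<psi>s \<nu>))" for es
  proof (rule result[OF es(1,2)])
    show "set_lim (\<lambda>\<nu>. eps_argmin (es \<nu>) (\<psi>s \<nu>)) (argmin \<psi>)"
      unfolding set_lim_def
      using lim_out_eps_argmin_subset[OF es(2)] es(3)
        lim_inn_subset_lim_out[of "\<lambda>\<nu>. eps_argmin (es \<nu>) (\<psi>s \<nu>)"]
      by (auto simp: eps_argmin_0)
  qed
  show thesis
  proof (cases "argmin \<psi> = {}")
    case True
    \<comment> \<open>Without minimizers any null tolerances do, because the outer limit is then
      empty as well.\<close>
    then show thesis by (intro sandwich[of "\<lambda>_. 0"]) auto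
  next
    case False
    obtain T where T: "countable T" "T \<subseteq> argmin \<psi>" "argmin \<psi> \<subseteq> closure T"
      by (rule separable)
    have "T \<noteq> {}" using T(3) False by auto
    define p where "p = from_nat_into T"
    have range_p: "range p = T"
      using T(1) \<open>T \<noteq> {}\<close> by (simp add: p_def)
    define Q where "Q k es zs \<longleftrightarrow> (\<forall>\<nu>. es \<nu> \<ge> 0) \<and> es \<longlonglongrightarrow> 0 \<and> zs \<longlonglongrightarrow> p k \<and>
        (\<forall>\<^sub>F \<nu> in sequentially. zs \<nu> \<in> eps_argmin (es \<nu>) (\<psi>s \<nu>))" for k es zs
    have "\<exists>es zs. Q k es zs" for k
    proof -
      obtain zs where zs: "zs \<longlonglongrightarrow> p k" "limsup (\<lambda>\<nu>. \<psi>s \<nu> (zs \<nu>)) \<le> \<psi> (p k)"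
        using epi unfolding epi_converges_def by blast
      have "\<psi> (p k) = ereal b"
        using T(2) range_p inf_limit by (auto simp: argmin_def)
      then show ?thesis
        using near_minimizers[OF inf zs(1)] zs unfolding Q_def by metis
    qed
    then obtain e zs where "\<And>k. Q k (e k) (zs k)" by metis
    then have e: "\<And>k \<nu>. e k \<nu> \<ge> 0" "\<And>k. e k \<longlonglongrightarrow> 0"
      and zs: "\<And>k. zs k \<longlonglongrightarrow> p k"
        "\<And>k. \<forall>\<^sub>F \<nu> in sequentially. zs k \<nu> \<in> eps_argmin (e k \<nu>) (\<psi>s \<nu>)"
      unfolding Q_def by auto
    obtain es where es: "\<And>\<nu>. es \<nu> \<ge> 0" "es \<longlonglongrightarrow> 0"
      "\<And>k. \<forall>\<^sub>F \<nu> in sequentially. e k \<nu> \<le> es \<nu>"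
      by (rule common_null_majorant[of e, OF e]) (rule that)
    \<comment> \<open>Enlarging the tolerance enlarges the set of approximate minimizers, so points
      selected for \<open>e k\<close> eventually remain valid for the common majorant
      \<open>es\<close>.\<close>
    have "p k \<in> lim_inn (\<lambda>\<nu>. eps_argmin (es \<nu>) (\<psi>s \<nu>))" for k
    proof -
      have "\<forall>\<^sub>F \<nu> in sequentially. zs k \<nu> \<in> eps_argmin (es \<nu>) (\<psi>s \<nu>)"
        using zs(2)[of k] es(3)[of k] by eventually_elim (rule subsetD[OF eps_argmin_mono])
      with zs(1)[of k] show ?thesis unfolding lim_inn_def by blast
    qed
    then have "T \<subseteq> lim_inn (\<lambda>\<nu>. eps_argmin (es \<nu>) (\<psi>s \<nu>))"
      by (auto simp flip: range_p)
    then have "argmin \<psi> \<subseteq> lim_inn (\<lambda>\<nu>. eps_argmin (es \<nu>) (\<psi>s \<nu>))"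
      using T(3) closure_minimal[OF _ closed_lim_inn] by (meson subset_trans)
    then show thesis by (rule sandwich[OF es(1,2)])
  qed
qed

section \<open>Lower semicontinuity along sequences and the penalty term\<close>

text \<open>\<open>lsc\<close> speaks of punctured neighbourhoods; adding the value at
  \<open>z\<close> itself gives full neighbourhoods, so \<open>zs\<close> may hit
  \<open>z\<close>.\<close>

lemma lsc_le_Liminf:
  assumes "lsc \<psi>" and zs: "(zs \<longlongrightarrow> z) F"
  shows "\<psi> z \<le> Liminf F (\<lambda>\<nu>. \<psi> (zs \<nu>))"
  unfolding le_Liminf_iff
proof (intro allI impI)
  fix c assume c: "c < \<psi> z"
  then have "\<forall>\<^sub>F w in at z. c < \<psi> w"
    using \<open>lsc \<psi>\<close> unfolding lsc_def le_Liminf_iff by blast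
  then have "\<forall>\<^sub>F w in nhds z. c < \<psi> w"
    using c by (auto simp: eventually_at_filter elim: eventually_mono)
  with zs show "\<forall>\<^sub>F \<nu> in F. c < \<psi> (zs \<nu>)"
    by (auto simp: filterlim_iff)
qed

text \<open>The componentwise minimum of \<open>ys \<nu>\<close> and \<open>y\<close> converges to \<open>y\<close> and lies below \<open>ys \<nu>\<close>.\<close>

lemma lsc_mono_le_liminf:
  fixes h :: "real^'m \<Rightarrow> ereal"
  assumes "lsc h" "mono h" and ys: "\<And>j. ereal (y $ j) \<le> liminf (\<lambda>\<nu>. ereal (ys \<nu> $ j))"
  shows "h y \<le> liminf (\<lambda>\<nu>. h (ys \<nu>))"
proof -
  define ws where "ws \<nu> = (\<chi> j. min (ys \<nu> $ j) (y $ j))" for \<nu>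
  have "(\<lambda>\<nu>. ws \<nu> $ j) \<longlonglongrightarrow> y $ j" for j
  proof (rule order_tendstoI)
    fix a assume a: "a < y $ j"
    then have "\<forall>\<^sub>F \<nu> in sequentially. ereal a < ereal (ys \<nu> $ j)"
      using ys[of j] unfolding le_Liminf_iff by (meson less_ereal.simps(1))
    then show "\<forall>\<^sub>F \<nu> in sequentially. a < ws \<nu> $ j"
      by eventually_elim (simp add: ws_def a)
  next
    fix a assume "y $ j < a"
    then show "\<forall>\<^sub>F \<nu> in sequentially. ws \<nu> $ j < a"
      by (auto simp: ws_def min_less_iff_disj)
  qed
  then have "ws \<longlonglongrightarrow> y" by (intro vec_tendstoI)
  then have "h y \<le> liminf (\<lambda>\<nu>. h (ws \<nu>))" by (rule lsc_le_Liminf[OF \<open>lsc h\<close>])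
  also have "\<dots> \<le> liminf (\<lambda>\<nu>. h (ys \<nu>))"
    by (intro Liminf_mono always_eventually allI monoD[OF \<open>mono h\<close>])
      (simp add: ws_def less_eq_vec_def)
  finally show ?thesis .
qed

text \<open>For \<open>u \<noteq> 0\<close> the power of the norm has a positive limit while
  \<open>1 / lam \<nu>\<close> blows up; for \<open>u = 0\<close> nonnegativity of the penalty is
  enough.\<close>

lemma penalty_liminf:
  fixes us :: "nat \<Rightarrow> 'a::real_normed_vector"
  assumes "\<alpha> > 0" and lam: "\<And>\<nu>. lam \<nu> > 0" "lam \<longlonglongrightarrow> 0" and us: "us \<longlonglongrightarrow> u"
  shows "indicator_fun {0} u \<le> liminf (\<lambda>\<nu>. ereal (1 / (\<alpha> * lam \<nu>) * norm (us \<nu>) powr \<alpha>))"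
proof (cases "u = 0")
  case True
  then show ?thesis
    using \<open>\<alpha> > 0\<close> lam(1)
    by (auto simp: indicator_fun_def less_imp_le intro!: Liminf_bounded always_eventually)
next
  case False
  have "(\<lambda>\<nu>. norm (us \<nu>) powr \<alpha>) \<longlonglongrightarrow> norm u powr \<alpha>"
    using us False by (intro tendsto_powr tendsto_norm tendsto_const) auto
  then have "(\<lambda>\<nu>. norm (us \<nu>) powr \<alpha> / \<alpha>) \<longlonglongrightarrow> norm u powr \<alpha> / \<alpha>"
    using \<open>\<alpha> > 0\<close> by (intro tendsto_divide tendsto_const) auto
  moreover have "norm u powr \<alpha> / \<alpha> > 0" using False \<open>\<alpha> > 0\<close> by simp
  moreover have "filterlim (\<lambda>\<nu>. inverse (lam \<nu>)) at_top sequentially"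
    using lam by (intro filterlim_inverse_at_top) auto
  ultimately have "filterlim (\<lambda>\<nu>. norm (us \<nu>) powr \<alpha> / \<alpha> * inverse (lam \<nu>)) at_top sequentially"
    by (rule filterlim_tendsto_pos_mult_at_top)
  then have "(\<lambda>\<nu>. ereal (norm (us \<nu>) powr \<alpha> / \<alpha> * inverse (lam \<nu>))) \<longlonglongrightarrow> \<infinity>"
    by (simp add: tendsto_PInfty_eq_at_top)
  then have "liminf (\<lambda>\<nu>. ereal (norm (us \<nu>) powr \<alpha> / \<alpha> * inverse (lam \<nu>))) = \<infinity>"
    by (rule lim_imp_Liminf[OF trivial_limit_sequentially])
  then show ?thesis by (simp add: field_simps)
qed

text \<open>The penalty is exactly \<open>1 / \<alpha>\<close> times the power with exponent
  \<open>\<alpha>\<close> of the norm of the rescaled vector, which explains the form of the rate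
  condition. Undoing the scaling costs a factor that also vanishes.\<close>

lemma penalty_tendsto_0:
  fixes us :: "nat \<Rightarrow> 'a::real_normed_vector"
  assumes "\<alpha> > 0" and lam: "\<And>\<nu>. lam \<nu> > 0" "lam \<longlonglongrightarrow> 0"
    and ws: "(\<lambda>\<nu>. lam \<nu> powr (- 1 / \<alpha>) *\<^sub>R us \<nu>) \<longlonglongrightarrow> 0"
  shows "us \<longlonglongrightarrow> 0" "(\<lambda>\<nu>. 1 / (\<alpha> * lam \<nu>) * norm (us \<nu>) powr \<alpha>) \<longlonglongrightarrow> 0"
proof -
  have "(\<lambda>\<nu>. lam \<nu> powr (1 / \<alpha>)) \<longlonglongrightarrow> 0 powr (1 / \<alpha>)"
    using lam \<open>\<alpha> > 0\<close>
    by (intro tendsto_powr' tendsto_const disjI2 conjI always_eventually allI) (auto simp: less_imp_le)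
  then have "(\<lambda>\<nu>. lam \<nu> powr (1 / \<alpha>) *\<^sub>R (lam \<nu> powr (- 1 / \<alpha>) *\<^sub>R us \<nu>)) \<longlonglongrightarrow> 0 powr (1 / \<alpha>) *\<^sub>R 0"
    using ws by (intro tendsto_scaleR)
  moreover have "lam \<nu> powr (1 / \<alpha>) *\<^sub>R (lam \<nu> powr (- 1 / \<alpha>) *\<^sub>R us \<nu>) = us \<nu>" for \<nu>
    using lam(1)[of \<nu>] by (simp flip: powr_add)
  ultimately show "us \<longlonglongrightarrow> 0" by simp
  have "(\<lambda>\<nu>. norm (lam \<nu> powr (- 1 / \<alpha>) *\<^sub>R us \<nu>) powr \<alpha>) \<longlonglongrightarrow> 0 powr \<alpha>"
    using tendsto_norm_zero[OF ws] \<open>\<alpha> > 0\<close>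
    by (intro tendsto_powr' tendsto_const disjI2 conjI always_eventually allI) auto
  then have "(\<lambda>\<nu>. 1 / \<alpha> * norm (lam \<nu> powr (- 1 / \<alpha>) *\<^sub>R us \<nu>) powr \<alpha>) \<longlonglongrightarrow> 1 / \<alpha> * 0 powr \<alpha>"
    by (intro tendsto_mult tendsto_const)
  moreover have "1 / \<alpha> * norm (lam \<nu> powr (- 1 / \<alpha>) *\<^sub>R us \<nu>) powr \<alpha>
      = 1 / (\<alpha> * lam \<nu>) * norm (us \<nu>) powr \<alpha>" for \<nu>
    using lam(1)[of \<nu>] \<open>\<alpha> > 0\<close>
    by (simp add: powr_mult powr_powr powr_minus field_simps powr_divide)
  ultimately show "(\<lambda>\<nu>. 1 / (\<alpha> * lam \<nu>) * norm (us \<nu>) powr \<alpha>) \<longlonglongrightarrow> 0" by simp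
qed

section \<open>Measurability and expectations\<close>

text \<open>Since epigraphs are closed, \<open>g \<xi> x \<le> t\<close> holds iff the epigraph of \<open>g \<xi>\<close> hits every ball
  around \<open>(x, t)\<close>.\<close>

lemma random_lsc_measurable:
  fixes g :: "'s::topological_space \<Rightarrow> 'a::metric_space \<Rightarrow> real"
  assumes "random_lsc \<Xi> (\<lambda>\<xi> x. ereal (g \<xi> x))"
  shows "(\<lambda>\<xi>. g \<xi> x) \<in> borel_measurable (restrict_space borel \<Xi>)"
  unfolding borel_measurable_iff_le
proof
  fix t
  let ?E = "\<lambda>\<xi>. epi (\<lambda>x. ereal (g \<xi> x))"
  let ?H = "\<lambda>k. {\<xi>\<in>\<Xi>. ?E \<xi> \<inter> ball (x, t) (1 / Suc k) \<noteq> {}}"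
  have "g \<xi> x \<le> t \<longleftrightarrow> (\<forall>k. ?E \<xi> \<inter> ball (x, t) (1 / Suc k) \<noteq> {})" if "\<xi> \<in> \<Xi>" for \<xi>
  proof -
    have "closed (?E \<xi>)" using assms that by (simp add: random_lsc_def)
    have "g \<xi> x \<le> t \<longleftrightarrow> (x, t) \<in> ?E \<xi>" by (simp add: epi_def)
    also have "\<dots> \<longleftrightarrow> (\<forall>e>0. ?E \<xi> \<inter> ball (x, t) e \<noteq> {})"
      using closed_approachable[OF \<open>closed (?E \<xi>)\<close>, of "(x, t)"]
      by (fastforce simp: disjoint_iff dist_commute)
    \<comment> \<open>Restricting to countably many radii makes the sublevel set a countable
      intersection of Borel hit sets.\<close>
    also have "\<dots> \<longleftrightarrow> (\<forall>k. ?E \<xi> \<inter> ball (x, t) (1 / Suc k) \<noteq> {})"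
    proof (intro iffI allI impI)
      fix e :: real assume *: "\<forall>k. ?E \<xi> \<inter> ball (x, t) (1 / Suc k) \<noteq> {}" and "e > 0"
      obtain k where "1 / real (Suc k) < e"
        using reals_Archimedean[OF \<open>e > 0\<close>] by (auto simp: inverse_eq_divide)
      then have "ball (x, t) (1 / Suc k) \<subseteq> ball (x, t) e" by (intro subset_ball) simp
      then show "?E \<xi> \<inter> ball (x, t) e \<noteq> {}" using *[rule_format, of k] by blast
    qed simp
    finally show ?thesis .
  qed
  then have eq: "{\<xi> \<in> space (restrict_space borel \<Xi>). g \<xi> x \<le> t} = \<Xi> \<inter> (\<Inter>k. ?H k)"
    by (auto simp: space_restrict_space)
  have "?H k \<in> sets borel" for k
    using assms by (simp add: random_lsc_def)
  then have "(\<Inter>k. ?H k) \<in> sets borel" by (intro sets.countable_INT) auto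
  then show "{\<xi> \<in> space (restrict_space borel \<Xi>). g \<xi> x \<le> t} \<in> sets (restrict_space borel \<Xi>)"
    unfolding eq sets_restrict_space by (rule imageI)
qed

text \<open>A bounded measurable function is integrable for a probability measure; measurability is
  checked on the components, which are the inner products with basis vectors.\<close>

lemma integrable_random_lsc_bounded:
  fixes g :: "'s::topological_space \<Rightarrow> 'a::metric_space \<Rightarrow> real^'m"
  assumes \<mu>: "\<mu> \<in> borel_probs \<Xi>" and g: "\<And>i. random_lsc \<Xi> (\<lambda>\<xi> x. ereal (g \<xi> x $ i))"
    and bound: "\<And>\<xi>. \<xi> \<in> \<Xi> \<Longrightarrow> norm (g \<xi> x) \<le> M"
  shows "integrable \<mu> (\<lambda>\<xi>. g \<xi> x)"
proof -
  interpret prob_space \<mu> using \<mu> by (simp add: borel_probs_def)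
  have sets: "sets \<mu> = sets (restrict_space borel \<Xi>)" using \<mu> by (simp add: borel_probs_def)
  then have "space \<mu> = \<Xi>" by (auto dest: sets_eq_imp_space_eq simp: space_restrict_space)
  then have "AE \<xi> in \<mu>. norm (g \<xi> x) \<le> M" using bound by (intro AE_I2) auto
  moreover have "(\<lambda>\<xi>. g \<xi> x) \<in> borel_measurable \<mu>"
  proof (subst borel_measurable_euclidean_space, rule ballI)
    fix b :: "real^'m" assume "b \<in> Basis"
    then obtain i where b: "b = axis i 1" by (auto simp: Basis_vec_def)
    have "(\<lambda>\<xi>. g \<xi> x $ i) \<in> borel_measurable \<mu>"
      unfolding measurable_cong_sets[OF sets refl] by (rule random_lsc_measurable[OF g])
    then show "(\<lambda>\<xi>. g \<xi> x \<bullet> b) \<in> borel_measurable \<mu>"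
      by (simp add: b inner_axis)
  qed
  ultimately show ?thesis by (rule integrable_const_bound)
qed

text \<open>The vector order is componentwise, and taking a component is bounded linear, hence
  commutes with the integral.\<close>

lemma integral_vec_mono_AE:
  fixes f g :: "'a \<Rightarrow> real^'m"
  assumes "integrable M f" "integrable M g" "AE x in M. f x \<le> g x"
  shows "integral\<^sup>L M f \<le> integral\<^sup>L M g"
  unfolding less_eq_vec_def
proof
  fix i
  have "(\<integral>x. f x $ i \<partial>M) \<le> (\<integral>x. g x $ i \<partial>M)"
    using assms
    by (intro integral_mono_AE integrable_bounded_linear[OF bounded_linear_vec_nth])
      (auto simp: less_eq_vec_def elim: eventually_mono)
  then show "integral\<^sup>L M f $ i \<le> integral\<^sup>L M g $ i"
    using assms(1,2) by (simp add: integral_bounded_linear[OF bounded_linear_vec_nth])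
qed

section \<open>The penalized relaxation of the expectation problem\<close>

theorem theorem2p3:
  fixes \<Xi> :: "(real^'d) set"
    and \<mu> :: "(real^'d) measure" and \<mu>' :: "nat \<Rightarrow> (real^'d) measure"
    and g0 :: "real^'n \<Rightarrow> ereal" and h :: "real^'m \<Rightarrow> ereal"
    and G :: "real^'d \<Rightarrow> real^'n \<Rightarrow> real^'m"
    and G' :: "nat \<Rightarrow> real^'d \<Rightarrow> real^'n \<Rightarrow> real^'m"
    and \<alpha> :: real and lam :: "nat \<Rightarrow> real"
    and \<phi> :: "real^'n \<Rightarrow> ereal"
    and f :: "(real^'m) \<times> (real^'n) \<Rightarrow> ereal"
    and f' :: "nat \<Rightarrow> (real^'m) \<times> (real^'n) \<Rightarrow> ereal"
    and x0 :: "real^'n" and \<epsilon> :: real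
  assumes Xi: "\<Xi> \<noteq> {}" "closed \<Xi>"
    and mu: "\<mu> \<in> borel_probs \<Xi>" "\<And>\<nu>. \<mu>' \<nu> \<in> borel_probs \<Xi>"
    and g0: "proper_fun g0" "lsc g0"
    and h: "proper_fun h" "lsc h" "mono h"
    and G: "\<And>i. random_lsc \<Xi> (\<lambda>\<xi> x. ereal (G \<xi> x $ i))"
    and G': "\<And>\<nu> i. random_lsc \<Xi> (\<lambda>\<xi> x. ereal (G' \<nu> \<xi> x $ i))"
    and bounded: "locally_uniformly_bounded \<Xi> G G'"
    and alpha: "\<alpha> \<ge> 1"
    and phi_def: "\<And>x. \<phi> x = g0 x + h (\<integral>\<xi>. G \<xi> x \<partial>\<mu>)"
    and f_def: "\<And>u x. f (u, x) = g0 x + h (u + (\<integral>\<xi>. G \<xi> x \<partial>\<mu>)) + indicator_fun {0} u"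
    and f'_def: "\<And>\<nu> u x. f' \<nu> (u, x) =
          g0 x + h (u + (\<integral>\<xi>. G' \<nu> \<xi> x \<partial>\<mu>' \<nu>))
            + ereal (1 / (\<alpha> * lam \<nu>) * norm u powr \<alpha>)"
    and x0: "x0 \<in> argmin \<phi>"
    and i: "\<And>\<nu>. AE \<xi> in \<mu>. G' \<nu> \<xi> x0 \<le> G \<xi> x0"
    and ii: "\<And>x xs j. xs \<longlonglongrightarrow> x \<Longrightarrow>
          ereal ((\<integral>\<xi>. G \<xi> x \<partial>\<mu>) $ j)
            \<le> liminf (\<lambda>\<nu>. ereal ((\<integral>\<xi>. G' \<nu> \<xi> (xs \<nu>) \<partial>\<mu>' \<nu>) $ j))"
    and lam: "\<And>\<nu>. lam \<nu> > 0" "lam \<longlonglongrightarrow> 0"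
    and iii: "(\<lambda>\<nu>. lam \<nu> powr (- 1 / \<alpha>) *\<^sub>R
          ((\<integral>\<xi>. G' \<nu> \<xi> x0 \<partial>\<mu>' \<nu>) - (\<integral>\<xi>. G' \<nu> \<xi> x0 \<partial>\<mu>))) \<longlonglongrightarrow> 0"
    and eps: "\<epsilon> \<ge> 0"
  shows
    "((INF z. f z) = (INF x. \<phi> x) \<and> eps_argmin \<epsilon> f = {0} \<times> eps_argmin \<epsilon> \<phi>)
     \<and> (limsup (\<lambda>\<nu>. INF z. f' \<nu> z) \<le> (INF z. f z))
     \<and> (\<forall>es. (\<forall>\<nu>. es \<nu> \<ge> 0) \<longrightarrow> es \<longlonglongrightarrow> \<epsilon> \<longrightarrow>
          lim_out (\<lambda>\<nu>. eps_argmin (es \<nu>) (f' \<nu>)) \<subseteq> eps_argmin \<epsilon> f)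
     \<and> (\<forall>es N zs. (\<forall>\<nu>. es \<nu> \<ge> 0) \<longrightarrow> es \<longlonglongrightarrow> 0 \<longrightarrow> infinite N \<longrightarrow>
          (\<forall>\<nu>\<in>N. zs \<nu> \<in> eps_argmin (es \<nu>) (f' \<nu>)) \<longrightarrow>
          (\<exists>z. (zs \<longlongrightarrow> z) (along N)) \<longrightarrow>
          ((\<lambda>\<nu>. INF z. f' \<nu> z) \<longlongrightarrow> (INF z. f z)) (along N))
     \<and> ((\<lambda>\<nu>. INF z. f' \<nu> z) \<longlonglongrightarrow> (INF z. f z) \<longleftrightarrow> tight_funs f')
     \<and> ((\<lambda>\<nu>. INF z. f' \<nu> z) \<longlonglongrightarrow> (INF z. f z) \<longrightarrow>
          (\<exists>es. (\<forall>\<nu>. es \<nu> \<ge> 0) \<and> es \<longlonglongrightarrow> 0 \<and>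
            (0, x0) \<in> lim_inn (\<lambda>\<nu>. eps_argmin (es \<nu>) (f' \<nu>))))
     \<and> ((\<forall>x \<in> eff_dom g0.
            (\<forall>\<nu>. AE \<xi> in \<mu>. G' \<nu> \<xi> x \<le> G \<xi> x) \<and>
            (\<lambda>\<nu>. lam \<nu> powr (- 1 / \<alpha>) *\<^sub>R
              ((\<integral>\<xi>. G' \<nu> \<xi> x \<partial>\<mu>' \<nu>) - (\<integral>\<xi>. G' \<nu> \<xi> x \<partial>\<mu>))) \<longlonglongrightarrow> 0) \<longrightarrow>
          epi_converges f' f \<and>
          ((\<lambda>\<nu>. INF z. f' \<nu> z) \<longlonglongrightarrow> (INF z. f z) \<longrightarrow>
            (\<exists>es. (\<forall>\<nu>. es \<nu> \<ge> 0) \<and> es \<longlonglongrightarrow> 0 \<and>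
              set_lim (\<lambda>\<nu>. eps_argmin (es \<nu>) (f' \<nu>)) (argmin f))))"
proof -
  define E where "E x = (\<integral>\<xi>. G \<xi> x \<partial>\<mu>)" for x
  define E' where "E' \<nu> x = (\<integral>\<xi>. G' \<nu> \<xi> x \<partial>\<mu>' \<nu>)" for \<nu> x
  \<comment> \<open>This mixed expectation separates the two approximations: domination compares
    \<open>D\<close> with \<open>E\<close>, where only the integrand changes, and the rate condition
    compares \<open>E'\<close> with \<open>D\<close>, where only the measure changes.\<close>
  define D where "D \<nu> x = (\<integral>\<xi>. G' \<nu> \<xi> x \<partial>\<mu>)" for \<nu> x
  have phi: "\<phi> x = g0 x + h (E x)" for x
    by (simp add: phi_def E_def)
  have f': "f' \<nu> (u, x) = g0 x + h (u + E' \<nu> x) + ereal (1 / (\<alpha> * lam \<nu>) * norm u powr \<alpha>)" for \<nu> u x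
    by (simp add: f'_def E'_def)
  have finite_below: "g0 x \<noteq> -\<infinity>" "h y \<noteq> -\<infinity>" for x y
    using g0(1) h(1) by (auto simp: proper_fun_def)
  have "\<alpha> > 0" using alpha by simp

  have f_eq: "f (u, x) = (if u = 0 then \<phi> x else \<infinity>)" for u x
    by (simp add: f_def phi_def indicator_fun_def)
  have inf_f: "(INF z. f z) = (INF x. \<phi> x)"
  proof (rule antisym)
    show "(INF z. f z) \<le> (INF x. \<phi> x)"
      by (rule INF_greatest, rule INF_lower2[of "(0, x)" for x]) (auto simp: f_eq)
    show "(INF x. \<phi> x) \<le> (INF z. f z)"
      by (rule INF_greatest) (auto simp: f_eq split_paired_all intro: INF_lower)
  qed
  have argmin_f: "eps_argmin e f = {0} \<times> eps_argmin e \<phi>" for e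
    unfolding eps_argmin_def inf_f by (auto simp: eff_dom_def f_eq split: if_splits)

  \<comment> \<open>The minimal value is real, as the abstract setting requires: \<open>x0\<close>
    lies in the effective domain, and neither \<open>g0\<close> nor \<open>h\<close> takes the value
    minus infinity.\<close>
  have "\<phi> x0 \<noteq> -\<infinity>" "\<phi> x0 \<noteq> \<infinity>"
    using x0 finite_below by (auto simp: phi argmin_def eff_dom_def)
  then obtain b where b: "\<phi> x0 = ereal b"
    by (cases "\<phi> x0") auto
  then have inf_b: "(INF z. f z) = ereal b"
    using x0 by (simp add: inf_f argmin_def)

  \<comment> \<open>The point \<open>x\<close> is kept general: the case \<open>x0\<close> gives the
    bound on infima, the other points serve epi-convergence.\<close>
  have recovery: "(\<lambda>\<nu>. (D \<nu> x - E' \<nu> x, x)) \<longlonglongrightarrow> (0, x)"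
      "limsup (\<lambda>\<nu>. f' \<nu> (D \<nu> x - E' \<nu> x, x)) \<le> \<phi> x"
    if le: "\<And>\<nu>. AE \<xi> in \<mu>. G' \<nu> \<xi> x \<le> G \<xi> x"
      and rate: "(\<lambda>\<nu>. lam \<nu> powr (- 1 / \<alpha>) *\<^sub>R (E' \<nu> x - D \<nu> x)) \<longlonglongrightarrow> 0" for x
  proof -
    \<comment> \<open>The local bound is evaluated at the centre of its ball, giving integrability
      of all integrands at \<open>x\<close>.\<close>
    obtain M where M: "\<And>\<nu> \<xi>. \<xi> \<in> \<Xi> \<Longrightarrow> norm (G \<xi> x) \<le> M \<and> norm (G' \<nu> \<xi> x) \<le> M"
      using bounded[unfolded locally_uniformly_bounded_def, rule_format, of x]
      by (metis dist_self less_imp_le)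
    have "D \<nu> x \<le> E x" for \<nu>
      unfolding D_def E_def using M
      by (intro integral_vec_mono_AE le integrable_random_lsc_bounded[OF mu(1) G, of x M]
          integrable_random_lsc_bounded[OF mu(1) G', of _ x M]) auto
    then have h_le: "h (D \<nu> x) \<le> h (E x)" for \<nu>
      using h(3) by (auto dest: monoD)
    \<comment> \<open>The recovery shift has the opposite sign of the difference in the rate
      condition.\<close>
    have rate': "(\<lambda>\<nu>. lam \<nu> powr (- 1 / \<alpha>) *\<^sub>R (D \<nu> x - E' \<nu> x)) \<longlonglongrightarrow> 0"
      using tendsto_minus[OF rate] by (simp add: algebra_simps)
    note pen = penalty_tendsto_0[OF \<open>\<alpha> > 0\<close> lam rate']
    show "(\<lambda>\<nu>. (D \<nu> x - E' \<nu> x, x)) \<longlonglongrightarrow> (0, x)"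
      by (intro tendsto_Pair pen(1) tendsto_const)
    let ?p = "\<lambda>\<nu>. 1 / (\<alpha> * lam \<nu>) * norm (D \<nu> x - E' \<nu> x) powr \<alpha>"
    have val: "f' \<nu> (D \<nu> x - E' \<nu> x, x) \<le> \<phi> x + ereal (?p \<nu>)" for \<nu>
      unfolding f' phi using h_le by (intro add_right_mono add_left_mono) simp
    show "limsup (\<lambda>\<nu>. f' \<nu> (D \<nu> x - E' \<nu> x, x)) \<le> \<phi> x"
    \<comment> \<open>Only a real value needs an argument: plus infinity is trivial as a bound and
      minus infinity cannot occur.\<close>
    proof (cases "\<phi> x")
      case (real c)
      have "(\<lambda>\<nu>. ereal (c + ?p \<nu>)) \<longlonglongrightarrow> ereal (c + 0)"
        by (intro tendsto_ereal tendsto_add tendsto_const pen(2))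
      then have "limsup (\<lambda>\<nu>. ereal (c + ?p \<nu>)) = ereal (c + 0)"
        by (rule lim_imp_Limsup[OF trivial_limit_sequentially])
      then have "limsup (\<lambda>\<nu>. \<phi> x + ereal (?p \<nu>)) = \<phi> x"
        by (simp add: real)
      moreover have "limsup (\<lambda>\<nu>. f' \<nu> (D \<nu> x - E' \<nu> x, x)) \<le> limsup (\<lambda>\<nu>. \<phi> x + ereal (?p \<nu>))"
        by (intro Limsup_mono always_eventually allI val)
      ultimately show ?thesis by (simp only:)
    qed (use finite_below in \<open>auto simp: phi\<close>)
  qed

  have lower: "f z \<le> liminf (\<lambda>\<nu>. f' \<nu> (zs \<nu>))" if zs: "zs \<longlonglongrightarrow> z" for zs z
  proof -
    obtain u x where z: "z = (u, x)" by (cases z)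
    define us where "us \<nu> = fst (zs \<nu>)" for \<nu>
    define xs where "xs \<nu> = snd (zs \<nu>)" for \<nu>
    have us: "us \<longlonglongrightarrow> u" and xs: "xs \<longlonglongrightarrow> x"
      using tendsto_fst[OF zs] tendsto_snd[OF zs] by (simp_all add: us_def[abs_def] xs_def[abs_def] z)
    define a where "a \<nu> = g0 (xs \<nu>)" for \<nu>
    define c where "c \<nu> = h (us \<nu> + E' \<nu> (xs \<nu>))" for \<nu>
    define p where "p \<nu> = ereal (1 / (\<alpha> * lam \<nu>) * norm (us \<nu>) powr \<alpha>)" for \<nu>
    have a: "g0 x \<le> liminf a"
      unfolding a_def by (rule lsc_le_Liminf[OF g0(2) xs])
    have c: "h (u + E x) \<le> liminf c"
      unfolding c_def
    \<comment> \<open>Since \<open>us\<close> converges, its limit can be pulled out of each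
      componentwise liminf; the assumption on expectations handles the rest.\<close>
    proof (rule lsc_mono_le_liminf[OF h(2,3)])
      fix j
      have "(\<lambda>\<nu>. ereal (us \<nu> $ j)) \<longlonglongrightarrow> ereal (u $ j)"
        by (intro tendsto_ereal tendsto_vec_nth us)
      then have "liminf (\<lambda>\<nu>. ereal (us \<nu> $ j) + ereal (E' \<nu> (xs \<nu>) $ j))
          = ereal (u $ j) + liminf (\<lambda>\<nu>. ereal (E' \<nu> (xs \<nu>) $ j))"
        by (rule ereal_liminf_lim_add) simp
      moreover have "ereal (E x $ j) \<le> liminf (\<lambda>\<nu>. ereal (E' \<nu> (xs \<nu>) $ j))"
        unfolding E_def E'_def by (rule ii[OF xs])
      then have "ereal (u $ j) + ereal (E x $ j) \<le> ereal (u $ j) + liminf (\<lambda>\<nu>. ereal (E' \<nu> (xs \<nu>) $ j))"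
        by (rule add_left_mono)
      ultimately show "ereal ((u + E x) $ j) \<le> liminf (\<lambda>\<nu>. ereal ((us \<nu> + E' \<nu> (xs \<nu>)) $ j))"
        by simp
    qed
    have p: "indicator_fun {0} u \<le> liminf p"
      unfolding p_def by (rule penalty_liminf[OF \<open>\<alpha> > 0\<close> lam us])
    \<comment> \<open>Superadditivity of the liminf breaks down when opposite infinities are added.
      The three lower bounds exclude minus infinity.\<close>
    have ninf: "liminf a \<noteq> -\<infinity>" "liminf c \<noteq> -\<infinity>" "liminf p \<noteq> -\<infinity>"
      using a c p finite_below by (auto simp: indicator_fun_def split: if_splits)
    have ac: "liminf a + liminf c \<le> liminf (\<lambda>\<nu>. a \<nu> + c \<nu>)"
      using ninf by (intro ereal_liminf_add_mono) auto
    have "liminf a + liminf c \<noteq> -\<infinity>" using ninf by simp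
    then have ninf_ac: "liminf (\<lambda>\<nu>. a \<nu> + c \<nu>) \<noteq> -\<infinity>" using ac by auto
    have "f z = g0 x + h (u + E x) + indicator_fun {0} u"
      by (simp add: z f_def E_def)
    also have "\<dots> \<le> liminf a + liminf c + liminf p"
      by (intro add_mono a c p)
    also have "\<dots> \<le> liminf (\<lambda>\<nu>. a \<nu> + c \<nu>) + liminf p"
      by (intro add_right_mono ac)
    also have "\<dots> \<le> liminf (\<lambda>\<nu>. a \<nu> + c \<nu> + p \<nu>)"
      using ninf(3) ninf_ac by (intro ereal_liminf_add_mono) auto
    also have "(\<lambda>\<nu>. a \<nu> + c \<nu> + p \<nu>) = (\<lambda>\<nu>. f' \<nu> (zs \<nu>))"
    proof
      fix \<nu>
      have "zs \<nu> = (us \<nu>, xs \<nu>)" by (simp add: us_def xs_def)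
      then show "a \<nu> + c \<nu> + p \<nu> = f' \<nu> (zs \<nu>)"
        by (simp only: f' a_def c_def p_def)
    qed
    finally show ?thesis .
  qed

  define rs where "rs \<nu> = (D \<nu> x0 - E' \<nu> x0, x0)" for \<nu>
  have rs: "rs \<longlonglongrightarrow> (0, x0)" "limsup (\<lambda>\<nu>. f' \<nu> (rs \<nu>)) \<le> ereal b"
    unfolding rs_def
    using recovery[of x0, OF i] iii unfolding E'_def[symmetric] D_def[symmetric] b by blast+
  \<comment> \<open>Each infimum is at most the value at the recovery point
    \<open>rs \<nu>\<close>.\<close>
  have limsup_b: "limsup (\<lambda>\<nu>. INF z. f' \<nu> z) \<le> ereal b"
    by (rule order_trans[OF Limsup_mono rs(2)]) (intro always_eventually allI INF_lower UNIV_I)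
  have epi_lim: "relaxed_epi_limit f' f b"
    using lower inf_b limsup_b by unfold_locales
  interpret relaxed_epi_limit f' f b by (rule epi_lim)

  have d: "((\<lambda>\<nu>. INF z. f' \<nu> z) \<longlongrightarrow> ereal b) (along N)"
    if "es \<longlonglongrightarrow> 0" "\<forall>\<nu>\<in>N. zs \<nu> \<in> eps_argmin (es \<nu>) (f' \<nu>)" "\<exists>z. (zs \<longlongrightarrow> z) (along N)" for es N zs
    using that(3) tendsto_inf_along[OF that(1) _ that(2)[rule_format]] by blast
  \<comment> \<open>The recovery sequence together with its limit is the compact set that witnesses
    tightness.\<close>
  have e: "(\<lambda>\<nu>. INF z. f' \<nu> z) \<longlonglongrightarrow> ereal b \<longleftrightarrow> tight_funs f'"
    using tight_if_tendsto_inf[OF _ compact_sequence_with_limit[OF rs(1)] insertI2[OF rangeI] rs(2)]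
      tendsto_inf_if_tight by (rule iffI)
  have f: "\<exists>es. (\<forall>\<nu>. es \<nu> \<ge> 0) \<and> es \<longlonglongrightarrow> 0 \<and> (0, x0) \<in> lim_inn (\<lambda>\<nu>. eps_argmin (es \<nu>) (f' \<nu>))"
    if "(\<lambda>\<nu>. INF z. f' \<nu> z) \<longlonglongrightarrow> ereal b"
  proof (rule near_minimizers[OF that rs])
    fix es assume es: "\<And>\<nu>. es \<nu> \<ge> 0" "es \<longlonglongrightarrow> 0"
      "\<forall>\<^sub>F \<nu> in sequentially. rs \<nu> \<in> eps_argmin (es \<nu>) (f' \<nu>)"
    then have "(0, x0) \<in> lim_inn (\<lambda>\<nu>. eps_argmin (es \<nu>) (f' \<nu>))"
      unfolding lim_inn_def using rs(1) by blast
    then show ?thesis using es(1,2) by blast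
  qed
  have epi: "epi_converges f' f"
    if *: "\<forall>x \<in> eff_dom g0.
            (\<forall>\<nu>. AE \<xi> in \<mu>. G' \<nu> \<xi> x \<le> G \<xi> x) \<and>
            (\<lambda>\<nu>. lam \<nu> powr (- 1 / \<alpha>) *\<^sub>R (E' \<nu> x - D \<nu> x)) \<longlonglongrightarrow> 0"
    unfolding epi_converges_def
  proof (intro allI conjI impI)
    fix z :: "(real^'m) \<times> (real^'n)"
    show "\<exists>zs. zs \<longlonglongrightarrow> z \<and> limsup (\<lambda>\<nu>. f' \<nu> (zs \<nu>)) \<le> f z"
    \<comment> \<open>Where \<open>f\<close> is infinite a constant sequence suffices. Elsewhere
      \<open>u = 0\<close> and \<open>x\<close> lies in the domain of \<open>g0\<close>, so the
      hypotheses apply at \<open>x\<close>.\<close>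
    proof (cases "f z = \<infinity>")
      case True
      then show ?thesis by (intro exI[of _ "\<lambda>_. z"]) simp
    next
      case False
      then obtain x where z: "z = (0, x)" and fz: "f z = \<phi> x" "\<phi> x \<noteq> \<infinity>"
        by (cases z) (auto simp: f_eq split: if_splits)
      then have "x \<in> eff_dom g0" by (auto simp: phi eff_dom_def)
      then have "(\<lambda>\<nu>. (D \<nu> x - E' \<nu> x, x)) \<longlonglongrightarrow> z"
        "limsup (\<lambda>\<nu>. f' \<nu> (D \<nu> x - E' \<nu> x, x)) \<le> f z"
        unfolding z[symmetric] fz using * recovery[of x] z by blast+
      then show ?thesis by blast
    qed
  qed (rule lower)
  have g: "\<exists>es. (\<forall>\<nu>. es \<nu> \<ge> 0) \<and> es \<longlonglongrightarrow> 0 \<and> set_lim (\<lambda>\<nu>. eps_argmin (es \<nu>) (f' \<nu>)) (argmin f)"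
    if "epi_converges f' f" "(\<lambda>\<nu>. INF z. f' \<nu> z) \<longlonglongrightarrow> ereal b"
    using argmin_set_lim[OF epi_lim that] by metis
  show ?thesis
    unfolding E_def[symmetric] E'_def[symmetric] D_def[symmetric] inf_b
  proof (intro conjI allI impI)
    show "ereal b = (INF x. \<phi> x)" using inf_f inf_b by simp
    show "((\<lambda>\<nu>. INF z. f' \<nu> z) \<longlongrightarrow> ereal b) (along N)"
      if "es \<longlonglongrightarrow> 0" "\<forall>\<nu>\<in>N. zs \<nu> \<in> eps_argmin (es \<nu>) (f' \<nu>)" "\<exists>z. (zs \<longlongrightarrow> z) (along N)" for es N zs
      using that by (rule d)
  qed (fact argmin_f limsup_b e | erule f epi lim_out_eps_argmin_subset | erule (1) g[OF epi])+
qed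

end
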